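(* Let $k\le\min(m,n)$, and let $X^*\in\mathcal M_{\le k}$ be a critical point of the problem $\min_{X\in\mathcal M_{\le k}}f(X)$ in the sense that $g^-(X^* )=0$. Then either $\operatorname{rank}(X^* )=k$ or $\nabla f(X^* )=0$.
   Context: $\mathcal M_{\le k}=\{X\in\mathbb R^{m\times n}:\operatorname{rank}(X)\le k\}$. The function $f:\mathcal D\to\mathbb R$ is continuously differentiable and bounded below on an open set $\mathcal D\subseteq\mathbb R^{m\times n}$ with $\mathcal M_{\le k}\subset\mathcal D$; $\mathbb R^{m\times n}$ carries the Frobenius inner product, with norm $\|\cdot\|_{\mathsf F}$ and distance $\mathrm{dist}_{\mathsf F}$. Tangent cone: $T_X\mathcal M_{\le k}=\{\Xi\in\mathbb R^{m\times n}:\exists (X_j)\subseteq\mathcal M_{\le k},\ (a_j)\subseteq\mathbb R^+,\ X_j\to X,\ a_j(X_j-X)\to\Xi\}$. Norm of the projected antigradient: $g^-(X)=\sqrt{\|\nabla f(X)\|_{\mathsf F}^2-\mathrm{dist}_{\mathsf F}(-\nabla f(X),T_X\mathcal M_{\le k})^2}$, equivalently $g^-(X)=\max\{-\langle\nabla f(X),\Xi\rangle_{\mathsf F}:\Xi\in T_X\mathcal M_{\le k},\ \|\Xi\|_{\mathsf F}\le1\}$. The "either ... or" is a non-exclusive disjunction. *)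

theory Defs
  imports "HOL-Analysis.Analysis"
begin

text \<open>
  Real matrices with \<open>m = CARD('m)\<close> rows and \<open>n = CARD('n)\<close> columns are elements of
  \<^typ>\<open>real^'n^'m\<close>. The inner product, norm and metric of this nested vector type are the
  Frobenius ones; see the two lemmas that follow.
\<close>

lemma inner_matrix_eq_Frobenius:
  fixes A B :: "real^'n^'m"
  shows "A \<bullet> B = (\<Sum>i\<in>UNIV. \<Sum>j\<in>UNIV. A $ i $ j * B $ i $ j)"
  by (simp add: inner_vec_def)

lemma norm_matrix_eq_Frobenius:
  fixes A :: "real^'n^'m"
  shows "norm A = sqrt (\<Sum>i\<in>UNIV. \<Sum>j\<in>UNIV. (A $ i $ j)\<^sup>2)"
  by (simp add: norm_eq_sqrt_inner inner_vec_def power2_eq_square)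

definition rank_le :: "nat \<Rightarrow> (real^'n^'m) set" where
  "rank_le k = {X. rank X \<le> k}"

definition tangent_cone :: "'a::real_normed_vector set \<Rightarrow> 'a \<Rightarrow> 'a set" where
  "tangent_cone S x = {\<xi>. \<exists>(X :: nat \<Rightarrow> 'a) (a :: nat \<Rightarrow> real).
     (\<forall>j. X j \<in> S) \<and> (\<forall>j. a j > 0) \<and> X \<longlonglongrightarrow> x \<and> (\<lambda>j. a j *\<^sub>R (X j - x)) \<longlonglongrightarrow> \<xi>}"

text \<open>The gradient is meaningful only where the function is differentiable.\<close>

definition gradient :: "('a::euclidean_space \<Rightarrow> real) \<Rightarrow> 'a \<Rightarrow> 'a" where
  "gradient f x = (THE D. GDERIV f x :> D)"

lemma gradient_eqI:
  assumes "GDERIV f x :> D"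
  shows "gradient f x = D"
  unfolding gradient_def
proof (rule the_equality[where P = "\<lambda>D. GDERIV f x :> D", OF assms])
  fix D' assume "GDERIV f x :> D'"
  with assms have "(\<lambda>h. h \<bullet> D') = (\<lambda>h. h \<bullet> D)"
    unfolding gderiv_def by (metis has_derivative_unique)
  then have "h \<bullet> D' = h \<bullet> D" for h
    by (rule fun_cong)
  then show "D' = D"
    by (metis vector_eq_ldot)
qed

lemma GDERIV_gradient:
  fixes f :: "'a::euclidean_space \<Rightarrow> real"
  assumes "f differentiable (at x)"
  shows "GDERIV f x :> gradient f x"
proof -
  obtain f' where f': "(f has_derivative f') (at x)"
    using assms unfolding differentiable_def by blast
  then have "linear f'"
    by (rule has_derivative_linear)
  then have "f' = (\<lambda>h. h \<bullet> adjoint f' 1)"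
    by (simp add: adjoint_works fun_eq_iff)
  with f' have "GDERIV f x :> adjoint f' 1"
    unfolding gderiv_def by metis
  then show ?thesis
    by (simp add: gradient_eqI)
qed

definition proj_antigrad_norm :: "nat \<Rightarrow> (real^'n^'m \<Rightarrow> real) \<Rightarrow> real^'n^'m \<Rightarrow> real" where
  "proj_antigrad_norm k f X =
     sqrt ((norm (gradient f X))\<^sup>2 - (infdist (- gradient f X) (tangent_cone (rank_le k) X))\<^sup>2)"

end

theory Submission
  imports Defs
begin

text \<open>
  Suppose that \<open>rank X < k\<close>. Adding a matrix of rank one raises the rank by at most one, so the
  whole line \<open>X + t u v\<^sup>T\<close> stays in the variety of matrices of rank at most \<open>k\<close>, and its
  direction, with either sign, is tangent there (\<open>rank_one_in_tangent_cone\<close>).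
  Criticality says that \<open>0\<close> is a nearest point to \<open>-\<nabla>f(X)\<close> in the tangent cone. The foot
  of the perpendicular from \<open>-\<nabla>f(X)\<close> to a line through \<open>0\<close> inside the cone would be strictly
  nearer unless the line is orthogonal to the gradient (\<open>orthogonal_if_zero_nearest_on_line\<close>).
  Hence the gradient is orthogonal to all matrices of rank one. Those with a single entry \<open>1\<close>
  read off its entries, so all entries vanish.
\<close>

lemma rank_add_rank_one_le:
  fixes A :: "real^'n^'m" and u :: "real^'m" and v :: "real^'n"
  shows "rank (A + (\<chi> i j. u $ i * v $ j)) \<le> Suc (rank A)"
proof -
  let ?B = "A + (\<chi> i j. u $ i * v $ j)"
  have "columns ?B \<subseteq> span (insert u (columns A))"
  proof
    fix c assume "c \<in> columns ?B"
    then obtain j where "c = column j ?B"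
      unfolding columns_def by blast
    then have "c = column j A + v $ j *\<^sub>R u"
      by (simp add: column_def vec_eq_iff)
    moreover have "column j A \<in> columns A"
      unfolding columns_def by blast
    ultimately show "c \<in> span (insert u (columns A))"
      by (simp add: span_add span_base span_scale)
  qed
  then have "dim (columns ?B) \<le> dim (insert u (columns A))"
    by (rule dim_subset[THEN order_trans]) (simp only: dim_span order_refl)
  also have "\<dots> \<le> Suc (dim (columns A))"
    by (simp add: dim_insert)
  finally show ?thesis
    by (simp only: column_rank_def)
qed

text \<open>The points \<open>x + \<xi> / j\<close>, rescaled by \<open>j\<close>, realise \<open>\<xi>\<close> exactly.\<close>

lemma tangent_cone_ray:
  assumes "\<And>t. t > 0 \<Longrightarrow> x + t *\<^sub>R \<xi> \<in> S"
  shows "\<xi> \<in> tangent_cone S x"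
proof -
  define a where "a = (\<lambda>j. real (Suc j))"
  define Y where "Y = (\<lambda>j. x + inverse (a j) *\<^sub>R \<xi>)"
  have pos: "a j > 0" for j
    by (simp add: a_def)
  have "Y j \<in> S" for j
    unfolding Y_def by (intro assms) (simp add: pos)
  moreover have "Y \<longlonglongrightarrow> x + 0 *\<^sub>R \<xi>"
    unfolding Y_def a_def by (intro tendsto_intros LIMSEQ_inverse_real_of_nat)
  moreover have "a j *\<^sub>R (Y j - x) = \<xi>" for j
    using pos[of j] by (simp add: Y_def)
  ultimately show ?thesis
    using pos unfolding tangent_cone_def
    by (auto intro!: exI[of _ Y] exI[of _ a])
qed

text \<open>
  At a point of rank less than \<open>k\<close> one more rank is available, which any matrix of rank one can use.
\<close>

lemma rank_one_in_tangent_cone: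
  fixes A :: "real^'n^'m" and u :: "real^'m" and v :: "real^'n"
  assumes "rank A < k"
  shows "(\<chi> i j. u $ i * v $ j) \<in> tangent_cone (rank_le k) A"
proof (rule tangent_cone_ray)
  fix t :: real
  have "t *\<^sub>R (\<chi> i j. u $ i * v $ j) = (\<chi> i j. (t *\<^sub>R u) $ i * v $ j)"
    by (simp add: vec_eq_iff)
  then show "A + t *\<^sub>R (\<chi> i j. u $ i * v $ j) \<in> rank_le k"
    using rank_add_rank_one_le[of A "t *\<^sub>R u" v] assms
    by (simp add: rank_le_def)
qed

lemma orthogonal_if_zero_nearest_on_line:
  fixes p e :: "'a::real_inner"
  assumes nearest: "infdist p C = norm p"
    and line: "\<And>t. t *\<^sub>R e \<in> C"
  shows "p \<bullet> e = 0"
proof (cases "e = 0")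
  case False
  \<comment> \<open>The multiple of \<open>e\<close> below is the orthogonal projection of \<open>p\<close> to the line.\<close>
  define t where "t = (p \<bullet> e) / (e \<bullet> e)"
  have "norm p \<le> norm (p - t *\<^sub>R e)"
    using infdist_le[OF line[of t], of p] nearest by (simp add: dist_norm)
  then have "p \<bullet> p \<le> (p - t *\<^sub>R e) \<bullet> (p - t *\<^sub>R e)"
    by (simp add: norm_le)
  also have "\<dots> = p \<bullet> p - (p \<bullet> e)\<^sup>2 / (e \<bullet> e)"
    using False
    by (simp add: t_def inner_diff_left inner_diff_right inner_commute field_simps power2_eq_square)
  finally have "(p \<bullet> e)\<^sup>2 / (e \<bullet> e) \<le> 0"
    by simp
  moreover have "e \<bullet> e > 0"
    using False by simp
  ultimately show ?thesis
    by (simp add: divide_le_0_iff)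
qed simp

theorem corollary3p4:
  fixes f :: "real^'n^'m \<Rightarrow> real"
    and D :: "(real^'n^'m) set"
    and k :: nat
    and X :: "real^'n^'m"
  assumes "open D"
    and "rank_le k \<subseteq> D"
    and "f differentiable_on D"
    and "continuous_on D (gradient f)"
    and "bdd_below (f ` D)"
    and "k \<le> min CARD('m) CARD('n)"
    and "X \<in> rank_le k"
    and "proj_antigrad_norm k f X = 0"
  shows "rank X = k \<or> gradient f X = 0"
proof (cases "rank X = k")
  case False
  with \<open>X \<in> rank_le k\<close> have less: "rank X < k"
    by (simp add: rank_le_def)
  define G where "G = gradient f X"
  have nearest: "infdist (- G) (tangent_cone (rank_le k) X) = norm (- G)"
    using \<open>proj_antigrad_norm k f X = 0\<close>
    by (simp add: proj_antigrad_norm_def G_def infdist_nonneg)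
  have "G $ i $ j = 0" for i j
  proof -
    define E :: "real^'n^'m" where "E = (\<chi> a b. axis i 1 $ a * axis j 1 $ b)"
    have "t *\<^sub>R E = (\<chi> a b. (t *\<^sub>R axis i 1) $ a * axis j 1 $ b)" for t
      by (simp add: E_def vec_eq_iff)
    then have "t *\<^sub>R E \<in> tangent_cone (rank_le k) X" for t
      using rank_one_in_tangent_cone[OF less] by metis
    with nearest have "- G \<bullet> E = 0"
      by (rule orthogonal_if_zero_nearest_on_line)
    moreover have "E = axis i (axis j 1)"
      by (simp add: E_def vec_eq_iff axis_def)
    ultimately show ?thesis
      by (simp add: inner_axis)
  qed
  then have "G = 0"
    by (simp add: vec_eq_iff)
  then show ?thesis
    by (simp add: G_def)
qed simp

end
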